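(* Let $0<q<p$, let $n\ge0$ be an integer, $a$ a real number and $s>0$. Then $$L_{p,q}\{t^ne_{p,q}(at)\}(s)=\frac{p^{n+1}q^{\binom{n+1}2}[n]_{p,q}!}{(p^{n+1}s-aq^n)(p^nqs-aq^n)\cdots(p^2q^{n-1}s-aq^n)(pq^ns-aq^n)}=\frac{p^{n+1}q^{\binom{n+1}2}[n]_{p,q}!}{\prod_{k=0}^n\left(p^{n+1-k}q^ks-aq^n\right)}.$$
   Context: Let $0<q<p$ be real numbers. For an integer $n\ge 0$, $[n]_{p,q}=\frac{p^n-q^n}{p-q}$, $[n]_{p,q}!=\prod_{k=1}^n[k]_{p,q}$ for $n\ge1$, $[0]_{p,q}!=1$. The $(p,q)$-exponentials are $e_{p,q}(z)=\sum_{n=0}^\infty\frac{p^{\binom n2}}{[n]_{p,q}!}z^n$ and $E_{p,q}(z)=\sum_{n=0}^\infty\frac{q^{\binom n2}}{[n]_{p,q}!}z^n$. The improper $(p,q)$-integral of $f$ on $[0,\infty)$ is $\int_0^\infty f(x)\,d_{p,q}x=(p-q)\sum_{j=-\infty}^{\infty}\frac{q^j}{p^{j+1}}f\!\left(\frac{q^j}{p^{j+1}}\right)$. The $(p,q)$-Laplace transform of the first kind of a function $f(t)$ is $L_{p,q}\{f(t)\}(s)=\int_0^\infty f(t)E_{p,q}(-qts)\,d_{p,q}t$, $s>0$.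
   Formalization: Assumes the (p,q)-integral converges and e_{p,q}(at) converges at each node t where E_{p,q}(-qts) is nonzero (other terms count as 0). This forces s=p^{m+1}/((p-q)q^m) for an integer m and |a|<ps; for other s>0 the integral diverges. *)

theory Defs
  imports "HOL-Analysis.Analysis"
begin

definition pq_int :: "real \<Rightarrow> real \<Rightarrow> nat \<Rightarrow> real" where
  "pq_int p q n = (p ^ n - q ^ n) / (p - q)"

definition pq_fact :: "real \<Rightarrow> real \<Rightarrow> nat \<Rightarrow> real" where
  "pq_fact p q n = (\<Prod>k=1..n. pq_int p q k)"

definition pq_exp_term :: "real \<Rightarrow> real \<Rightarrow> real \<Rightarrow> nat \<Rightarrow> real" where
  "pq_exp_term p q z n = p ^ (n choose 2) / pq_fact p q n * z ^ n"

text \<open>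
  The series of the small exponential \<open>e\<close> converges only for \<open>\<bar>z\<bar> < p / (p - q)\<close>; elsewhere the
  value of \<open>pq_exp\<close> is meaningless. The series of the big exponential \<open>E\<close> converges everywhere.
\<close>

definition pq_exp_converges :: "real \<Rightarrow> real \<Rightarrow> real \<Rightarrow> bool" where
  "pq_exp_converges p q z \<longleftrightarrow> summable (pq_exp_term p q z)"

definition pq_exp :: "real \<Rightarrow> real \<Rightarrow> real \<Rightarrow> real" where
  "pq_exp p q z = (\<Sum>n. pq_exp_term p q z n)"

definition pq_Exp :: "real \<Rightarrow> real \<Rightarrow> real \<Rightarrow> real" where
  "pq_Exp p q z = (\<Sum>n. q ^ (n choose 2) / pq_fact p q n * z ^ n)"

definition pq_node :: "real \<Rightarrow> real \<Rightarrow> int \<Rightarrow> real" where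
  "pq_node p q j = q powi j / p powi (j + 1)"

text \<open>
  A series over all integers is read in the usual way: it converges if its two halves (over
  \<open>j \<ge> 0\<close> and over \<open>j < 0\<close>) converge, and its value is the sum of the two.
\<close>

definition bilateral_summable :: "(int \<Rightarrow> real) \<Rightarrow> bool" where
  "bilateral_summable g \<longleftrightarrow>
     summable (\<lambda>i::nat. g (int i)) \<and> summable (\<lambda>i::nat. g (- int (Suc i)))"

definition bilateral_suminf :: "(int \<Rightarrow> real) \<Rightarrow> real" where
  "bilateral_suminf g = (\<Sum>i::nat. g (int i)) + (\<Sum>i::nat. g (- int (Suc i)))"

definition pq_integrable :: "real \<Rightarrow> real \<Rightarrow> (real \<Rightarrow> real) \<Rightarrow> bool" where
  "pq_integrable p q f \<longleftrightarrow>
     bilateral_summable (\<lambda>j. pq_node p q j * f (pq_node p q j))"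

definition pq_integral :: "real \<Rightarrow> real \<Rightarrow> (real \<Rightarrow> real) \<Rightarrow> real" where
  "pq_integral p q f =
     (p - q) * bilateral_suminf (\<lambda>j. pq_node p q j * f (pq_node p q j))"

definition pq_laplace_converges ::
    "real \<Rightarrow> real \<Rightarrow> (real \<Rightarrow> real) \<Rightarrow> real \<Rightarrow> bool" where
  "pq_laplace_converges p q f s \<longleftrightarrow>
     pq_integrable p q (\<lambda>t. f t * pq_Exp p q (- q * t * s))"

definition pq_laplace :: "real \<Rightarrow> real \<Rightarrow> (real \<Rightarrow> real) \<Rightarrow> real \<Rightarrow> real" where
  "pq_laplace p q f s =
     pq_integral p q (\<lambda>t. f t * pq_Exp p q (- q * t * s))"

end

theory Submission
  imports Defs
begin

text \<open>
  The exponentials satisfy \<open>E(p z) = (1 + (p - q) z) E(q z)\<close> and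
  \<open>e(q z) = (1 - (p - q) z) e(p z)\<close>. At the nodes \<open>x\<^sub>j\<close> the first equation reads
  \<open>F\<^sub>j = (1 - (p - q) s x\<^sub>j\<^sub>+\<^sub>1) F\<^sub>j\<^sub>+\<^sub>1\<close> for \<open>F\<^sub>j = E(- q s x\<^sub>j)\<close>. If no factor vanishes, no \<open>F\<^sub>j\<close>
  does, so the small exponential has to converge at all \<open>a x\<^sub>j\<close>, which forces \<open>a = 0\<close>; but then
  the terms of the integral grow as \<open>j \<rightarrow> -\<infinity>\<close>. Hence \<open>(p - q) s x\<^sub>m = 1\<close> for some \<open>m\<close>, and
  the integral is a sum over \<open>j \<ge> m\<close> only. Shifting the summation index by one turns the two functional equations into
  \<open>(p\<^sup>n\<^sup>+\<^sup>1 s - a q\<^sup>n) I\<^sub>n = p [n] I\<^sub>n\<^sub>-\<^sub>1\<close>, and \<open>I\<^sub>0\<close> telescopes.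
\<close>

text \<open>Divergence test applied twice: to the series of the small exponential outside its
  convergence interval, and to the terms of the integral at large nodes.\<close>

lemma not_tendsto_0_if_abs_eventually_mono:
  fixes f :: "nat \<Rightarrow> real"
  assumes "\<And>i. i \<ge> N \<Longrightarrow> \<bar>f i\<bar> \<le> \<bar>f (Suc i)\<bar>" and "f N \<noteq> 0"
  shows "\<not> f \<longlonglongrightarrow> 0"
proof
  assume "f \<longlonglongrightarrow> 0"
  have mono: "\<bar>f N\<bar> \<le> \<bar>f i\<bar>" if "i \<ge> N" for i
    using that by (induction i rule: dec_induct) (use assms(1) in force)+
  have "(\<lambda>i. \<bar>f i\<bar>) \<longlonglongrightarrow> 0"
    using \<open>f \<longlonglongrightarrow> 0\<close> by (simp add: tendsto_rabs_zero)
  then have "\<bar>f N\<bar> \<le> 0"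
    by (rule LIMSEQ_le_const) (use mono in blast)
  then show False using assms(2) by simp
qed

section \<open>Growth of (p,q)-integers and the two exponentials\<close>

lemma pq_int_Suc_ge:
  assumes "0 < q" and "q < p"
  shows "p ^ n \<le> pq_int p q (Suc n)"
proof -
  have "q ^ n \<le> p ^ n" using assms by (intro power_mono) auto
  then have "q * q ^ n \<le> q * p ^ n" using assms by (intro mult_left_mono) auto
  then show ?thesis
    using assms by (simp add: pq_int_def field_simps)
qed

lemma pq_int_Suc_pos:
  assumes "0 < q" and "q < p"
  shows "0 < pq_int p q (Suc n)"
  using pq_int_Suc_ge[OF assms, of n] assms zero_less_power[of p n] by linarith

lemma pq_fact_0 [simp]: "pq_fact p q 0 = 1"
  by (simp add: pq_fact_def)

lemma pq_fact_Suc: "pq_fact p q (Suc n) = pq_fact p q n * pq_int p q (Suc n)"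
  by (simp add: pq_fact_def)

lemma choose_2_Suc: "Suc n choose 2 = (n choose 2) + n"
  by (simp add: numeral_2_eq_2)

text \<open>Taking \<open>w = q\<close> gives the coefficients of the big exponential and
  \<open>w = p\<close> those of the small one, so one recursion serves both.\<close>

lemma pq_exp_coeff_Suc:
  "w ^ (Suc n choose 2) / pq_fact p q (Suc n) =
     w ^ n / pq_int p q (Suc n) * (w ^ (n choose 2) / pq_fact p q n)"
  by (simp add: pq_fact_Suc choose_2_Suc power_add mult_ac)

text \<open>Since \<open>p ^ Suc n - q ^ Suc n\<close> equals
  \<open>(p - q) * pq_int p q (Suc n)\<close>, the recursion \<open>step\<close> cancels the
  (p,q)-integer. The remaining \<open>w ^ n\<close> dilates the argument to
  \<open>w * z\<close>.\<close>

lemma powser_pq_difference: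
  fixes c :: "nat \<Rightarrow> real"
  assumes "q \<noteq> p"
    and step: "\<And>n. c (Suc n) = w ^ n / pq_int p q (Suc n) * c n"
    and nz: "\<And>n. pq_int p q (Suc n) \<noteq> 0"
    and sp: "summable (\<lambda>n. c n * (p * z) ^ n)" and sq: "summable (\<lambda>n. c n * (q * z) ^ n)"
    and sw: "summable (\<lambda>n. c n * (w * z) ^ n)"
  shows "(\<Sum>n. c n * (p * z) ^ n) - (\<Sum>n. c n * (q * z) ^ n) =
           (p - q) * z * (\<Sum>n. c n * (w * z) ^ n)"
proof -
  let ?d = "\<lambda>n. c n * (p * z) ^ n - c n * (q * z) ^ n"
  have "?d (Suc n) = (p - q) * z * (c n * (w * z) ^ n)" for n
  proof -
    have "p ^ Suc n - q ^ Suc n = (p - q) * pq_int p q (Suc n)"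
      using assms(1) by (simp add: pq_int_def)
    moreover have "?d (Suc n) = c (Suc n) * z ^ Suc n * (p ^ Suc n - q ^ Suc n)"
      by (simp add: power_mult_distrib algebra_simps)
    ultimately show ?thesis
      using nz[of n] by (simp add: step power_mult_distrib)
  qed
  then have "(\<Sum>n. ?d (Suc n)) = (p - q) * z * (\<Sum>n. c n * (w * z) ^ n)"
    using sw by (simp add: suminf_mult)
  \<comment> \<open>The constant terms of the two series agree, so \<open>?d 0 = 0\<close> and the
    shift loses nothing.\<close>
  moreover have "(\<Sum>n. ?d (Suc n)) = (\<Sum>n. ?d n)"
    using suminf_split_head[OF summable_diff[OF sp sq]] by simp
  ultimately show ?thesis
    using suminf_diff[OF sp sq] by simp
qed

text \<open>By \<open>pq_int_Suc_ge\<close> the ratio of consecutive terms is at most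
  \<open>(q / p) ^ n * \<bar>z\<bar>\<close>, which tends to 0 for every \<open>z\<close>.\<close>

lemma summable_pq_Exp:
  assumes "0 < q" and "q < p"
  shows "summable (\<lambda>n. q ^ (n choose 2) / pq_fact p q n * z ^ n)"
proof -
  have "(\<lambda>n. (q / p) ^ n * \<bar>z\<bar>) \<longlonglongrightarrow> 0 * \<bar>z\<bar>"
    using assms by (intro tendsto_intros LIMSEQ_realpow_zero) auto
  then have "\<forall>\<^sub>F n in sequentially. (q / p) ^ n * \<bar>z\<bar> < 1 / 2"
    by (intro order_tendstoD) auto
  then obtain N where N: "\<And>n. n \<ge> N \<Longrightarrow> (q / p) ^ n * \<bar>z\<bar> < 1 / 2"
    by (auto simp: eventually_sequentially)
  show ?thesis
  proof (rule summable_ratio_test[of "1/2" N])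
    fix n assume "n \<ge> N"
    have "q ^ n / pq_int p q (Suc n) \<le> q ^ n / p ^ n"
      using assms pq_int_Suc_ge[OF assms] by (intro divide_left_mono) (auto simp: pq_int_Suc_pos)
    then have "q ^ n / pq_int p q (Suc n) * \<bar>z\<bar> \<le> (q / p) ^ n * \<bar>z\<bar>"
      unfolding power_divide by (rule mult_right_mono) simp
    then have *: "q ^ n / pq_int p q (Suc n) * \<bar>z\<bar> \<le> 1 / 2"
      using N[OF \<open>n \<ge> N\<close>] by linarith
    have "norm (q ^ (Suc n choose 2) / pq_fact p q (Suc n) * z ^ Suc n) =
        (q ^ n / pq_int p q (Suc n) * \<bar>z\<bar>) * norm (q ^ (n choose 2) / pq_fact p q n * z ^ n)"
      using assms pq_int_Suc_pos[OF assms, of n]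
      by (simp add: pq_exp_coeff_Suc abs_mult power_abs)
    also have "\<dots> \<le> 1 / 2 * norm (q ^ (n choose 2) / pq_fact p q n * z ^ n)"
      by (rule mult_right_mono[OF *]) simp
    finally show "norm (q ^ (Suc n choose 2) / pq_fact p q (Suc n) * z ^ Suc n)
        \<le> 1 / 2 * norm (q ^ (n choose 2) / pq_fact p q n * z ^ n)" .
  qed simp
qed

lemma pq_Exp_functional:
  assumes "0 < q" and "q < p"
  shows "pq_Exp p q (p * z) = (1 + (p - q) * z) * pq_Exp p q (q * z)"
proof -
  have "pq_Exp p q (p * z) - pq_Exp p q (q * z) = (p - q) * z * pq_Exp p q (q * z)"
    unfolding pq_Exp_def
    using assms pq_int_Suc_pos[OF assms]
    by (intro powser_pq_difference summable_pq_Exp pq_exp_coeff_Suc) (auto simp: less_imp_neq[symmetric])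
  then show ?thesis by (simp add: algebra_simps)
qed

lemma pq_exp_functional:
  assumes "0 < q" and "q < p" and conv: "pq_exp_converges p q (p * z)"
  shows "pq_exp p q (q * z) = (1 - (p - q) * z) * pq_exp p q (p * z)"
proof -
  have sp: "summable (\<lambda>n. p ^ (n choose 2) / pq_fact p q n * (p * z) ^ n)"
    using conv by (simp add: pq_exp_converges_def pq_exp_term_def[abs_def])
  have sq: "summable (\<lambda>n. p ^ (n choose 2) / pq_fact p q n * (q * z) ^ n)"
  \<comment> \<open>\<open>powser_inside\<close> needs the strict inequality between
    \<open>q * z\<close> and \<open>p * z\<close> in absolute value, which fails only at 0.\<close>
  proof (cases "z = 0")
    case True
    then show ?thesis using sp by simp
  next
    case False
    then show ?thesis
      using assms by (intro powser_inside[OF sp]) (simp add: abs_mult)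
  qed
  have "pq_exp p q (p * z) - pq_exp p q (q * z) = (p - q) * z * pq_exp p q (p * z)"
    unfolding pq_exp_def pq_exp_term_def
    using assms(1,2) pq_int_Suc_pos[OF assms(1,2)]
    by (intro powser_pq_difference sp sq pq_exp_coeff_Suc) (auto simp: less_imp_neq[symmetric])
  then show ?thesis by (simp add: algebra_simps)
qed

text \<open>When \<open>(p - q) * \<bar>z\<bar>\<close> is at least \<open>p\<close>, every ratio of
  consecutive terms is at least 1 in absolute value, because \<open>p ^ Suc n - q ^ Suc n\<close> is
  below \<open>p ^ Suc n\<close>. The terms start at 1 and so cannot decay, even on the
  boundary.\<close>

lemma pq_exp_converges_imp_bound:
  assumes "0 < q" and "q < p" and conv: "pq_exp_converges p q z"
  shows "(p - q) * \<bar>z\<bar> < p"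
proof (rule ccontr)
  assume "\<not> ?thesis"
  then have big: "p \<le> (p - q) * \<bar>z\<bar>" by simp
  have "pq_exp_term p q z \<longlonglongrightarrow> 0"
    using conv by (auto simp: pq_exp_converges_def intro: summable_LIMSEQ_zero)
  moreover have "\<not> pq_exp_term p q z \<longlonglongrightarrow> 0"
  proof (rule not_tendsto_0_if_abs_eventually_mono[of 0])
    fix n :: nat
    have "p ^ Suc n \<le> p ^ n * ((p - q) * \<bar>z\<bar>)"
      using mult_left_mono[OF big, of "p ^ n"] assms by (simp add: mult.commute)
    then have "p ^ Suc n - q ^ Suc n \<le> p ^ n * ((p - q) * \<bar>z\<bar>)"
      using assms zero_less_power[of q "Suc n"] by linarith
    then have "pq_int p q (Suc n) \<le> p ^ n * \<bar>z\<bar>"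
      using assms by (simp add: pq_int_def field_simps)
    then have *: "1 \<le> p ^ n / pq_int p q (Suc n) * \<bar>z\<bar>"
      using pq_int_Suc_pos[OF assms(1,2), of n] by simp
    have "\<bar>pq_exp_term p q z (Suc n)\<bar> =
        (p ^ n / pq_int p q (Suc n) * \<bar>z\<bar>) * \<bar>pq_exp_term p q z n\<bar>"
      using assms pq_int_Suc_pos[OF assms(1,2), of n]
      by (simp add: pq_exp_term_def pq_exp_coeff_Suc abs_mult power_abs)
    then show "\<bar>pq_exp_term p q z n\<bar> \<le> \<bar>pq_exp_term p q z (Suc n)\<bar>"
      using mult_right_mono[OF *, of "\<bar>pq_exp_term p q z n\<bar>"] by simp
  qed (simp add: pq_exp_term_def)
  ultimately show False by contradiction
qed

lemma pq_exp_0 [simp]: "pq_exp p q 0 = 1"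
  using powser_zero[of "\<lambda>n. p ^ (n choose 2) / pq_fact p q n"]
  by (simp add: pq_exp_def pq_exp_term_def numeral_2_eq_2)

lemma pq_Exp_0 [simp]: "pq_Exp p q 0 = 1"
  using powser_zero[of "\<lambda>n. q ^ (n choose 2) / pq_fact p q n"]
  by (simp add: pq_Exp_def numeral_2_eq_2)

text \<open>Convergence at one nonzero point gives a positive radius of convergence, hence
  continuity at 0.\<close>

lemma pq_exp_tendsto_1:
  assumes "pq_exp_converges p q z" and "r \<longlonglongrightarrow> 0"
  shows "(\<lambda>i. pq_exp p q (z * r i)) \<longlonglongrightarrow> 1"
proof (cases "z = 0")
  case False
  have "summable (\<lambda>n. p ^ (n choose 2) / pq_fact p q n * z ^ n)"
    using assms by (simp add: pq_exp_converges_def pq_exp_term_def[abs_def])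
  then have "isCont (pq_exp p q) 0"
    unfolding pq_exp_def[abs_def] pq_exp_term_def
    by (rule isCont_powser) (use False in simp)
  moreover have "(\<lambda>i. z * r i) \<longlonglongrightarrow> 0"
    using assms(2) by (rule tendsto_mult_right_zero)
  ultimately show ?thesis
    using isCont_tendsto_compose by fastforce
qed simp

lemma pq_Exp_tendsto_1:
  assumes "0 < q" and "q < p" and "r \<longlonglongrightarrow> 0"
  shows "(\<lambda>i. pq_Exp p q (r i)) \<longlonglongrightarrow> 1"
proof -
  have "isCont (pq_Exp p q) 0"
    unfolding pq_Exp_def[abs_def]
    by (rule isCont_powser[OF summable_pq_Exp[OF assms(1,2), of 1]]) simp
  then show ?thesis
    using isCont_tendsto_compose assms(3) by fastforce
qed

section \<open>The integration nodes as a geometric sequence\<close>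

lemma pq_node_add:
  assumes "0 < q" and "q < p"
  shows "pq_node p q (j + int k) = pq_node p q j * (q / p) ^ k"
proof -
  have "p powi (j + int k + 1) = p powi (j + 1) * p ^ k"
    using assms power_int_add[of p "j + 1" "int k"] by (simp add: add_ac)
  then show ?thesis
    using assms by (simp add: pq_node_def power_int_add power_divide)
qed

lemma pq_node_Suc:
  assumes "0 < q" and "q < p"
  shows "pq_node p q (j + 1) = pq_node p q j * (q / p)"
  using pq_node_add[OF assms, of j 1] by simp

lemma pq_node_pos:
  assumes "0 < q" and "q < p"
  shows "0 < pq_node p q j"
  using assms by (simp add: pq_node_def zero_less_power_int)

lemma pq_node_strict_antimono:
  assumes "0 < q" and "q < p" and "i < j"
  shows "pq_node p q j < pq_node p q i"
proof -
  obtain k where k: "j = i + int (Suc k)"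
    using assms(3) zless_iff_Suc_zadd by blast
  have "(q / p) ^ Suc k < 1"
    using assms by (intro power_Suc_less_one) auto
  then show ?thesis
    using mult_strict_left_mono[OF _ pq_node_pos[OF assms(1,2), of i]]
    unfolding k pq_node_add[OF assms(1,2)] by fastforce
qed

lemma pq_node_unbounded:
  assumes "0 < q" and "q < p"
  obtains i where "B < pq_node p q (- int (Suc i))"
proof -
  have "1 < p / q" using assms by simp
  \<comment> \<open>Going backwards each node grows by the factor \<open>p / q\<close>, so
    \<open>i\<close> steps from node \<open>-1\<close> must exceed the quotient of \<open>B\<close>
    by that node.\<close>
  then obtain i where i: "B * pq_node p q (- 1) powi (- 1) < (p / q) ^ i"
    using real_arch_pow by blast
  have "pq_node p q (- 1) = pq_node p q (- int (Suc i)) * (q / p) ^ i"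
    using pq_node_add[OF assms, of "- int (Suc i)" i] by simp
  then have "pq_node p q (- int (Suc i)) = (p / q) ^ i * pq_node p q (- 1)"
    using assms by (simp add: power_divide)
  then show ?thesis
    using that[of i] i pq_node_pos[OF assms, of "- 1"] by (simp add: field_simps)
qed

lemma pq_node_tendsto_0:
  assumes "0 < q" and "q < p"
  shows "(\<lambda>k. pq_node p q (j + int k)) \<longlonglongrightarrow> 0"
  unfolding pq_node_add[OF assms]
  using assms by (intro tendsto_mult_right_zero LIMSEQ_realpow_zero) auto

section \<open>The big exponential along the nodes\<close>

lemma pq_Exp_node_step:
  assumes "0 < q" and "q < p"
  shows "pq_Exp p q (- q * pq_node p q j * s) =
           (1 - (p - q) * s * pq_node p q (j + 1)) * pq_Exp p q (- q * pq_node p q (j + 1) * s)"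
  using pq_Exp_functional[OF assms, of "- pq_node p q (j + 1) * s"] assms
  by (simp add: pq_node_Suc[OF assms] mult_ac)

text \<open>With nonzero factors, a zero at node \<open>j\<close> would propagate to all later
  nodes. These tend to 0, where the big exponential has the value 1.\<close>

lemma pq_Exp_node_nonzero:
  assumes "0 < q" and "q < p"
    and nonres: "\<And>i. j < i \<Longrightarrow> (p - q) * s * pq_node p q i \<noteq> 1"
  shows "pq_Exp p q (- q * pq_node p q j * s) \<noteq> 0"
proof
  assume 0: "pq_Exp p q (- q * pq_node p q j * s) = 0"
  have "pq_Exp p q (- q * pq_node p q (j + int k) * s) = 0" for k
  proof (induction k)
    case (Suc k)
    then show ?case
      using pq_Exp_node_step[OF assms(1,2), of "j + int k" s] nonres[of "j + int k + 1"]
      by (simp add: add_ac)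
  qed (use 0 in simp)
  moreover have "(\<lambda>k. - q * pq_node p q (j + int k) * s) \<longlonglongrightarrow> 0"
    using pq_node_tendsto_0[OF assms(1,2), of j]
    by (intro tendsto_mult_left_zero tendsto_mult_right_zero)
  then have "(\<lambda>k. pq_Exp p q (- q * pq_node p q (j + int k) * s)) \<longlonglongrightarrow> 1"
    by (rule pq_Exp_tendsto_1[OF assms(1,2)])
  ultimately show False by (simp add: LIMSEQ_const_iff)
qed

text \<open>The factor between nodes \<open>m - 1\<close> and \<open>m\<close> vanishes, and the
  product recursion carries this zero to all smaller indices.\<close>

lemma pq_Exp_node_zero:
  assumes "0 < q" and "q < p"
    and res: "(p - q) * s * pq_node p q m = 1" and "j < m"
  shows "pq_Exp p q (- q * pq_node p q j * s) = 0"
proof -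
  have "j \<le> m - 1" using assms(4) by simp
  then show ?thesis
  proof (induction j rule: int_le_induct)
    case base
    show ?case using pq_Exp_node_step[OF assms(1,2), of "m - 1" s] res by simp
  next
    case (step i)
    then show ?case using pq_Exp_node_step[OF assms(1,2), of "i - 1" s] by simp
  qed
qed

text \<open>The convergence hypotheses confine \<open>s\<close> to the discrete set of values
  \<open>p powi (m + 1) / ((p - q) * q powi m)\<close> with \<open>m\<close> an integer.\<close>

lemma pq_laplace_resonance:
  assumes "0 < q" and "q < p" and "s > 0"
    and exp_converges: "\<And>j::int. pq_Exp p q (- q * pq_node p q j * s) \<noteq> 0 \<Longrightarrow>
           pq_exp_converges p q (a * pq_node p q j)"
    and conv: "pq_laplace_converges p q (\<lambda>t. t ^ n * pq_exp p q (a * t)) s"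
  obtains m where "(p - q) * s * pq_node p q m = 1"
proof -
  have False if nonres: "\<And>m. (p - q) * s * pq_node p q m \<noteq> 1"
  proof -
    let ?x = "\<lambda>i. pq_node p q (- int (Suc i))"
    let ?F = "\<lambda>i. pq_Exp p q (- q * ?x i * s)"
    have nz: "pq_Exp p q (- q * pq_node p q j * s) \<noteq> 0" for j
      using pq_Exp_node_nonzero[OF assms(1,2)] nonres by blast
    have "a = 0"
    proof (rule ccontr)
      assume "a \<noteq> 0"
      \<comment> \<open>This node is so large that \<open>a * ?x i\<close> leaves the convergence
        interval of the small exponential.\<close>
      obtain i where i: "p / ((p - q) * \<bar>a\<bar>) < ?x i"
        using pq_node_unbounded[OF assms(1,2)] .
      have "(p - q) * \<bar>a * ?x i\<bar> < p"
        using pq_exp_converges_imp_bound[OF assms(1,2) exp_converges[OF nz]] .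
      then show False
        using i \<open>a \<noteq> 0\<close> assms pq_node_pos[OF assms(1,2), of "- int (Suc i)"]
        by (simp add: abs_mult field_simps)
    qed
    \<comment> \<open>These are the summands over negative indices: one power of the node is the
      weight of the integral, the other \<open>n\<close> come from \<open>t ^ n\<close>, and
      \<open>a = 0\<close> makes the small exponential 1.\<close>
    define f where "f i = ?x i ^ Suc n * ?F i" for i
    have "f \<longlonglongrightarrow> 0"
      using conv \<open>a = 0\<close>
      by (auto simp: pq_laplace_converges_def pq_integrable_def bilateral_summable_def f_def[abs_def]
          mult_ac dest!: summable_LIMSEQ_zero)
    \<comment> \<open>Beyond this threshold \<open>1 - (p - q) * s * ?x i\<close> is below
      \<open>-1\<close>, so the big exponential does not shrink in absolute value from one node to
      the next larger one.\<close>
    moreover obtain N where N: "2 / ((p - q) * s) < ?x N"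
      using pq_node_unbounded[OF assms(1,2)] .
    have "\<not> f \<longlonglongrightarrow> 0"
    proof (rule not_tendsto_0_if_abs_eventually_mono)
      show "f N \<noteq> 0"
        using nz pq_node_pos[OF assms(1,2)] by (simp add: f_def less_imp_neq[symmetric])
      fix i assume "N \<le> i"
      then have "?x N \<le> ?x i"
        using pq_node_strict_antimono[OF assms(1,2), of "- int (Suc i)" "- int (Suc N)"]
        by (cases "i = N") auto
      then have "2 / ((p - q) * s) < ?x i"
        using N by linarith
      then have "2 < (p - q) * s * ?x i"
        using assms(1-3) by (simp add: field_simps)
      then have "1 \<le> \<bar>1 - (p - q) * s * ?x i\<bar>" by simp
      then have "1 * \<bar>?F i\<bar> \<le> \<bar>1 - (p - q) * s * ?x i\<bar> * \<bar>?F i\<bar>"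
        by (rule mult_right_mono) simp
      then have F: "\<bar>?F i\<bar> \<le> \<bar>?F (Suc i)\<bar>"
        using pq_Exp_node_step[OF assms(1,2), of "- int (Suc (Suc i))" s]
        by (simp add: abs_mult)
      have "?x i ^ Suc n \<le> ?x (Suc i) ^ Suc n"
        using pq_node_strict_antimono[OF assms(1,2), of "- int (Suc (Suc i))" "- int (Suc i)"]
          pq_node_pos[OF assms(1,2), of "- int (Suc i)"]
        by (intro power_mono) auto
      then have "?x i ^ Suc n * \<bar>?F i\<bar> \<le> ?x (Suc i) ^ Suc n * \<bar>?F (Suc i)\<bar>"
        using F pq_node_pos[OF assms(1,2)] by (intro mult_mono) (auto simp: less_imp_le)
      moreover have "\<bar>f k\<bar> = ?x k ^ Suc n * \<bar>?F k\<bar>" for k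
        using pq_node_pos[OF assms(1,2), of "- int (Suc k)"] by (simp add: f_def abs_mult)
      ultimately show "\<bar>f i\<bar> \<le> \<bar>f (Suc i)\<bar>" by simp
    qed
    ultimately show False by contradiction
  qed
  then show ?thesis using that by blast
qed

section \<open>The sum starting at the resonant node\<close>

lemma bilateral_suminf_eq_from:
  assumes "bilateral_summable g" and 0: "\<And>j. j < m \<Longrightarrow> g j = 0"
  shows "bilateral_suminf g = (\<Sum>i. g (m + int i))"
proof (cases "m \<ge> 0")
  case True
  then obtain k where k: "m = int k" using nonneg_int_cases by blast
  have s: "summable (\<lambda>i. g (int i))" using assms by (simp add: bilateral_summable_def)
  have "(\<Sum>i. g (- int (Suc i))) = 0" using 0 True by simp
  moreover have "(\<Sum>i. g (int i)) = (\<Sum>i. g (int (i + k)))"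
    using suminf_split_initial_segment[OF s, of k] 0 k by simp
  ultimately show ?thesis by (simp add: bilateral_suminf_def k add.commute)
next
  case False
  then obtain k where k: "m = - int k" using neg_int_cases[of m] by (metis not_le)
  have s: "summable (\<lambda>i. g (int i))" using assms by (simp add: bilateral_summable_def)
  have shift: "g (m + int (i + k)) = g (int i)" for i using k by simp
  then have sm: "summable (\<lambda>i. g (m + int i))"
    using s summable_iff_shift[of "\<lambda>i. g (m + int i)" k] by simp
  have "(\<Sum>i. g (- int (Suc i))) = (\<Sum>i<k. g (- int (Suc i)))"
    by (rule suminf_finite) (use 0 k in auto)
  \<comment> \<open>The reversal of \<open>i\<close> to \<open>k - Suc i\<close> sends
    \<open>- int (Suc i)\<close> to \<open>m + int i\<close>.\<close>
  also have "\<dots> = (\<Sum>i<k. g (m + int i))"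
    by (subst sum.nat_diff_reindex[symmetric]) (auto simp: k of_nat_diff intro!: sum.cong)
  finally show ?thesis
    using suminf_split_initial_segment[OF sm, of k] shift by (simp add: bilateral_suminf_def)
qed

text \<open>The sequences stand for the nodes from the resonant one on and for the two exponentials
  there. By \<open>x0\<close> the factor at index 0 vanishes, which removes every boundary term when
  the summation is shifted.\<close>

lemma pq_sum_closed_form:
  fixes x F G :: "nat \<Rightarrow> real"
  assumes "0 < q" and "q < p"
    and x: "\<And>i. x (Suc i) = x i * (q / p)"
    and F: "\<And>i. F i = (1 - (p - q) * s * x (Suc i)) * F (Suc i)"
    and G: "\<And>i. G (Suc i) = (1 - (p - q) * (a / p) * x i) * G i"
    and x0: "(p - q) * s * x 0 = 1"
    and "F \<longlonglongrightarrow> 1" and "G \<longlonglongrightarrow> 1" and "a < p * s" and "s > 0"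
  shows "(p - q) * (\<Sum>i. x i ^ Suc n * F i * G i) =
           p ^ (n + 1) * q ^ ((n + 1) choose 2) * pq_fact p q n /
             (\<Prod>k=0..n. p ^ (n + 1 - k) * q ^ k * s - a * q ^ n)"
proof -
  have p: "p > 0" using assms(1,2) by simp
  have x_eq: "x i = x 0 * (q / p) ^ i" for i
    by (induction i) (simp_all add: x)
  \<comment> \<open>The product \<open>F i * G i\<close> is bounded and \<open>x i ^ Suc n\<close>
    is geometric. All \<open>n\<close> are covered because the recursion below links consecutive
    exponents.\<close>
  have summ: "summable (\<lambda>i. x i ^ Suc n * F i * G i)" for n
  proof -
    have "(\<lambda>i. F i * G i) \<longlonglongrightarrow> 1 * 1"
      by (intro tendsto_mult assms)
    then have "Bseq (\<lambda>i. F i * G i)"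
      by (intro convergent_imp_Bseq convergentI)
    then obtain K where K: "\<And>i. norm (F i * G i) \<le> K"
      by (auto simp: Bseq_def)
    have "(q / p) ^ Suc n < 1"
      using assms(1,2) by (intro power_Suc_less_one) auto
    then have "summable (\<lambda>i. \<bar>x 0\<bar> ^ Suc n * K * ((q / p) ^ Suc n) ^ i)"
      using assms(1,2) by (intro summable_mult summable_geometric) auto
    moreover have "norm (x i ^ Suc n * F i * G i) \<le> \<bar>x 0\<bar> ^ Suc n * K * ((q / p) ^ Suc n) ^ i" for i
    proof -
      have "norm (x i ^ Suc n * F i * G i) = \<bar>x 0\<bar> ^ Suc n * ((q / p) ^ Suc n) ^ i * norm (F i * G i)"
        using assms(1,2)
        by (simp add: x_eq[of i] abs_mult power_abs power_mult_distrib power_mult[symmetric]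
            power_divide mult_ac del: power_Suc)
      also have "\<dots> \<le> \<bar>x 0\<bar> ^ Suc n * ((q / p) ^ Suc n) ^ i * K"
        using assms(1,2) K by (intro mult_left_mono) auto
      finally show ?thesis by (simp add: mult_ac)
    qed
    ultimately show ?thesis by (rule summable_comparison_test'[where N = 0])
  qed
  define S where "S n = (\<Sum>i. x i ^ Suc n * F i * G i)" for n
  have den: "p ^ Suc n * s - a * q ^ n > 0" for n
  proof -
    have "a * q ^ n < p * s * q ^ n" using assms by simp
    also have "\<dots> \<le> p * s * p ^ n"
      using assms by (intro mult_left_mono power_mono) auto
    finally show ?thesis by (simp add: mult_ac)
  qed
  have base: "(p * s - a) * ((p - q) * S 0) = p"
  proof -
    \<comment> \<open>The recursion for \<open>F\<close> turns \<open>T (Suc i)\<close> into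
      \<open>F i * G (Suc i)\<close>. The recursion for \<open>G\<close> then makes the increment of
      \<open>T\<close> a multiple of the summand of \<open>S 0\<close>, while \<open>T\<close> runs
      from 0 to the limit 1.\<close>
    define T where "T i = (1 - (p - q) * s * x i) * F i * G i" for i
    have T_Suc: "T (Suc i) = F i * G (Suc i)" for i
      by (simp add: T_def F[of i])
    have "(\<lambda>i. T (Suc i)) \<longlonglongrightarrow> 1 * 1"
      unfolding T_Suc by (intro tendsto_mult assms LIMSEQ_Suc)
    then have "T \<longlonglongrightarrow> 1" by (simp add: filterlim_sequentially_Suc)
    then have "(\<lambda>i. T (Suc i) - T i) sums (1 - T 0)"
      by (rule telescope_sums)
    moreover have "T 0 = 0" by (simp add: T_def x0)
    moreover have "T (Suc i) - T i = (p - q) * (s - a / p) * (x i ^ Suc 0 * F i * G i)" for i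
      unfolding T_Suc by (simp add: T_def G algebra_simps)
    ultimately have "(\<lambda>i. (p - q) * (s - a / p) * (x i ^ Suc 0 * F i * G i)) sums 1"
      by simp
    then have "(p - q) * (s - a / p) * S 0 = 1"
      using summ[of 0] by (simp add: sums_iff suminf_mult S_def)
    moreover have "p * (s - a / p) = p * s - a" using p by (simp add: field_simps)
    ultimately show ?thesis by (metis mult.assoc mult.commute mult.right_neutral)
  qed
  have rec: "(p ^ Suc (Suc n) * s - a * q ^ Suc n) * S (Suc n) = p * pq_int p q (Suc n) * S n" for n
  proof -
    let ?r = "(q / p) ^ Suc n"
    \<comment> \<open>The sum of \<open>T\<close> is computed twice: by expanding the extra factor,
      and after an index shift by the recursions for \<open>F\<close>, \<open>G\<close> and
      \<open>x\<close>. Equating the results relates \<open>S (Suc n)\<close> to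
      \<open>S n\<close>.\<close>
    define T where "T i = x i ^ Suc n * (1 - (p - q) * s * x i) * F i * G i" for i
    have "T = (\<lambda>i. x i ^ Suc n * F i * G i - (p - q) * s * (x i ^ Suc (Suc n) * F i * G i))"
      by (simp add: fun_eq_iff T_def algebra_simps)
    then have 1: "T sums (S n - (p - q) * s * S (Suc n))"
      unfolding S_def by (simp only:) (intro sums_diff sums_mult summable_sums summ)
    have "T (Suc i) = ?r * (x i ^ Suc n * F i * G i) -
        ?r * ((p - q) * (a / p)) * (x i ^ Suc (Suc n) * F i * G i)" for i
    proof -
      have "T (Suc i) = x (Suc i) ^ Suc n * F i * G (Suc i)"
        by (simp add: T_def F[of i])
      then show ?thesis
        unfolding G x power_mult_distrib by (simp only: power_Suc algebra_simps mult_1_left)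
    qed
    then have "(\<lambda>i. T (Suc i)) sums (?r * S n - ?r * ((p - q) * (a / p)) * S (Suc n))"
      unfolding S_def by (simp only:) (intro sums_diff sums_mult summable_sums summ)
    moreover have "T 0 = 0" by (simp add: T_def x0)
    ultimately have "T sums (?r * S n - ?r * ((p - q) * (a / p)) * S (Suc n))"
      using sums_Suc_iff[of T] by simp
    then have "S n - (p - q) * s * S (Suc n) = ?r * S n - ?r * ((p - q) * (a / p)) * S (Suc n)"
      using 1 sums_unique2 by blast
    then have "(p - q) * (s - ?r * (a / p)) * S (Suc n) = (1 - ?r) * S n"
      by (simp add: algebra_simps)
    \<comment> \<open>The multiplier clears the powers of \<open>p\<close> from
      \<open>?r * (a / p)\<close>.\<close>
    then have "p * p ^ Suc n * ((p - q) * (s - ?r * (a / p)) * S (Suc n)) =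
        p * p ^ Suc n * ((1 - ?r) * S n)" by simp
    moreover have "p * p ^ Suc n * ((p - q) * (s - ?r * (a / p)) * S (Suc n)) =
        (p - q) * ((p ^ Suc (Suc n) * s - a * q ^ Suc n) * S (Suc n))"
      using p by (simp add: power_divide field_simps)
    moreover have "p * p ^ Suc n * ((1 - ?r) * S n) = (p - q) * (p * pq_int p q (Suc n) * S n)"
      using p assms(2) by (simp add: power_divide pq_int_def field_simps)
    ultimately have "(p - q) * ((p ^ Suc (Suc n) * s - a * q ^ Suc n) * S (Suc n)) =
        (p - q) * (p * pq_int p q (Suc n) * S n)"
      by (simp only:)
    then show ?thesis
      by (rule mult_left_cancel[THEN iffD1, rotated]) (use assms(2) in simp)
  qed
  \<comment> \<open>The factor for \<open>k = 0\<close> is split off. After shifting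
    \<open>k\<close>, each of the remaining \<open>n + 1\<close> factors contains a
    \<open>q\<close>.\<close>
  have prod_Suc: "(\<Prod>k=0..Suc n. p ^ (Suc n + 1 - k) * q ^ k * s - a * q ^ Suc n) =
      (p ^ Suc (Suc n) * s - a * q ^ Suc n) * (q ^ Suc n *
        (\<Prod>k=0..n. p ^ (n + 1 - k) * q ^ k * s - a * q ^ n))" for n
  proof -
    have "(\<Prod>k=0..n. p ^ (n + 1 - k) * q ^ Suc k * s - a * q ^ Suc n) =
        (\<Prod>k=0..n. q * (p ^ (n + 1 - k) * q ^ k * s - a * q ^ n))"
      by (intro prod.cong) (simp_all add: algebra_simps)
    also have "\<dots> = q ^ Suc n * (\<Prod>k=0..n. p ^ (n + 1 - k) * q ^ k * s - a * q ^ n)"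
      by (simp add: prod.distrib)
    finally show ?thesis
      by (simp only: prod.atLeast0_atMost_Suc_shift o_def) simp
  qed
  have "(p - q) * S n = p ^ (n + 1) * q ^ ((n + 1) choose 2) * pq_fact p q n /
             (\<Prod>k=0..n. p ^ (n + 1 - k) * q ^ k * s - a * q ^ n)"
  proof (induction n)
    case 0
    have "p * s - a > 0" using den[of 0] by simp
    then show ?case using base by (simp add: field_simps numeral_2_eq_2)
  next
    case (Suc n)
    let ?D = "p ^ Suc (Suc n) * s - a * q ^ Suc n"
    let ?P = "\<Prod>k=0..n. p ^ (n + 1 - k) * q ^ k * s - a * q ^ n"
    have "?D \<noteq> 0" using den[of "Suc n"] by simp
    then have "(p - q) * S (Suc n) = p * pq_int p q (Suc n) * ((p - q) * S n) / ?D"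
      using rec[of n] by (simp add: field_simps del: power_Suc)
    also have "\<dots> = p * pq_int p q (Suc n) *
        (p ^ (n + 1) * q ^ ((n + 1) choose 2) * pq_fact p q n / ?P) / ?D"
      by (simp only: Suc.IH)
    \<comment> \<open>The inserted \<open>q ^ Suc n\<close> completes the product below and raises
      the exponent above from \<open>(n + 1) choose 2\<close> to
      \<open>(n + 2) choose 2\<close>.\<close>
    also have "\<dots> = q ^ Suc n * (p * pq_int p q (Suc n) * (p ^ (n + 1) * q ^ ((n + 1) choose 2) *
        pq_fact p q n)) / (q ^ Suc n * (?D * ?P))"
      by (subst mult_divide_mult_cancel_left) (use assms(1) in \<open>simp_all add: mult.commute\<close>)
    also have "q ^ Suc n * (p * pq_int p q (Suc n) * (p ^ (n + 1) * q ^ ((n + 1) choose 2) *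
        pq_fact p q n)) = p ^ (Suc n + 1) * q ^ ((Suc n + 1) choose 2) * pq_fact p q (Suc n)"
      using choose_2_Suc[of "Suc n"] by (simp add: pq_fact_Suc power_add mult_ac)
    also have "q ^ Suc n * (?D * ?P) = ?D * (q ^ Suc n * ?P)"
      by (rule mult.left_commute)
    finally show ?case by (simp only: prod_Suc)
  qed
  then show ?thesis by (simp add: S_def)
qed

text \<open>Convergence of the small exponential is demanded only at nodes where the big one is
  nonzero: elsewhere the summand is 0, whatever value \<open>pq_exp\<close> takes.\<close>

theorem corollary3p10:
  fixes p q a s :: real and n :: nat
  assumes "0 < q" and "q < p" and "s > 0"
    and exp_converges: "\<And>j::int. pq_Exp p q (- q * pq_node p q j * s) \<noteq> 0 \<Longrightarrow>
           pq_exp_converges p q (a * pq_node p q j)"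
    and laplace_converges: "pq_laplace_converges p q (\<lambda>t. t ^ n * pq_exp p q (a * t)) s"
  shows "pq_laplace p q (\<lambda>t. t ^ n * pq_exp p q (a * t)) s =
           p ^ (n + 1) * q ^ ((n + 1) choose 2) * pq_fact p q n /
             (\<Prod>k=0..n. p ^ (n + 1 - k) * q ^ k * s - a * q ^ n)"
proof -
  obtain m where m: "(p - q) * s * pq_node p q m = 1"
    using pq_laplace_resonance[OF assms] .
  define x where "x i = pq_node p q (m + int i)" for i
  define F where "F i = pq_Exp p q (- q * x i * s)" for i
  define G where "G i = pq_exp p q (a * x i)" for i
  have x_lim: "x \<longlonglongrightarrow> 0"
    unfolding x_def by (rule pq_node_tendsto_0[OF assms(1,2)])
  have x_Suc: "x (Suc i) = x i * (q / p)" for i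
    using pq_node_Suc[OF assms(1,2), of "m + int i"] by (simp add: x_def add_ac)
  have conv: "pq_exp_converges p q (a * x i)" for i
    unfolding x_def
  proof (intro exp_converges pq_Exp_node_nonzero assms)
    \<comment> \<open>Nodes decrease strictly, so beyond \<open>m\<close> the quantity
      \<open>(p - q) * s * pq_node p q j\<close> is below 1.\<close>
    fix j assume "m + int i < j"
    then have "pq_node p q j < pq_node p q m"
      by (intro pq_node_strict_antimono assms) simp
    then show "(p - q) * s * pq_node p q j \<noteq> 1"
      using m assms(2,3) by (metis diff_gt_0_iff_gt less_irrefl mult_less_cancel_left_pos mult_pos_pos)
  qed
  \<comment> \<open>Convergence at the resonant node bounds
    \<open>(p - q) * \<bar>a\<bar> * x 0\<close> by \<open>p\<close>; multiplying by
    \<open>s\<close> and using the resonance leaves \<open>\<bar>a\<bar> < s * p\<close>.\<close>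
  have bound: "a < p * s"
  proof -
    have "(p - q) * (\<bar>a\<bar> * x 0) < p"
      using pq_exp_converges_imp_bound[OF assms(1,2) conv[of 0]] pq_node_pos[OF assms(1,2), of m]
      by (simp add: x_def abs_mult)
    then have "s * ((p - q) * (\<bar>a\<bar> * x 0)) < s * p"
      using assms by simp
    moreover have "s * ((p - q) * (\<bar>a\<bar> * x 0)) = \<bar>a\<bar> * ((p - q) * s * x 0)"
      by (simp only: mult_ac)
    moreover have "(p - q) * s * x 0 = 1" using m by (simp add: x_def)
    ultimately have "\<bar>a\<bar> < s * p" by simp
    then show ?thesis by (simp add: mult.commute)
  qed
  have "pq_laplace p q (\<lambda>t. t ^ n * pq_exp p q (a * t)) s =
      (p - q) * (\<Sum>i. x i * (x i ^ n * pq_exp p q (a * x i) * pq_Exp p q (- q * x i * s)))"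
    unfolding pq_laplace_def pq_integral_def x_def
    by (subst bilateral_suminf_eq_from[where m = m])
      (use laplace_converges pq_Exp_node_zero[OF assms(1,2) m] in
        \<open>auto simp: pq_laplace_converges_def pq_integrable_def\<close>)
  also have "\<dots> = (p - q) * (\<Sum>i. x i ^ Suc n * F i * G i)"
    by (simp add: F_def G_def mult_ac)
  also have "\<dots> = p ^ (n + 1) * q ^ ((n + 1) choose 2) * pq_fact p q n /
             (\<Prod>k=0..n. p ^ (n + 1 - k) * q ^ k * s - a * q ^ n)"
  proof (rule pq_sum_closed_form[where x = x, OF assms(1,2) x_Suc])
    show "F i = (1 - (p - q) * s * x (Suc i)) * F (Suc i)" for i
      using pq_Exp_node_step[OF assms(1,2), of "m + int i" s] by (simp add: F_def x_def add_ac)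
    show "G (Suc i) = (1 - (p - q) * (a / p) * x i) * G i" for i
    proof -
      have "p * (a * x i / p) = a * x i" "q * (a * x i / p) = a * x (Suc i)"
        using assms(1,2) by (simp_all add: x_Suc)
      then show ?thesis
        using pq_exp_functional[OF assms(1,2), of "a * x i / p"] conv[of i]
        by (simp add: G_def mult_ac)
    qed
    have "(\<lambda>i. - q * x i * s) \<longlonglongrightarrow> 0"
      using x_lim by (intro tendsto_mult_left_zero tendsto_mult_right_zero)
    then show "F \<longlonglongrightarrow> 1"
      unfolding F_def by (rule pq_Exp_tendsto_1[OF assms(1,2)])
    have "(\<lambda>i. (q / p) ^ i) \<longlonglongrightarrow> 0"
      using assms(1,2) by (intro LIMSEQ_realpow_zero) auto
    then have "(\<lambda>i. pq_exp p q (a * x 0 * (q / p) ^ i)) \<longlonglongrightarrow> 1"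
      by (rule pq_exp_tendsto_1[OF conv])
    then show "G \<longlonglongrightarrow> 1"
      using pq_node_add[OF assms(1,2), of m] by (simp add: G_def[abs_def] x_def mult_ac)
  qed (use m bound assms in \<open>simp_all add: x_def\<close>)
  finally show ?thesis .
qed

end
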